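(* Let $M$ be a finite loopless matroid with ground set $E$ and rank function $r$, such that $|E|$ and $r(M)=r(E)$ are coprime, i.e. $\gcd(|E|,r(M))=1$. Then there is a cyclic ordering of $E$ such that every $r(M)$ cyclically consecutive elements form a base of $M$ if and only if for every non-empty $A\subseteq E$ we have \[\frac{|A|}{r(A)}\le\frac{|E|}{r(M)}.\]
   Context: A cyclic ordering $(e_1,\dots,e_m)$ of $E$ (with $m=|E|$) is an ordering of all elements of $E$ considered cyclically; a set of $k$ cyclically consecutive elements is a set $\{e_i,e_{i+1},\dots,e_{i+k-1}\}$ with indices taken modulo $m$. *)

theory Defs
  imports Complex_Main
begin

text \<open>Finite matroids, presented by their independent sets.\<close>

locale matroid =
  fixes E :: "'a set" and indep :: "'a set \<Rightarrow> bool"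
  assumes finite_ground: "finite E"
    and indep_subset_ground: "indep X \<Longrightarrow> X \<subseteq> E"
    and indep_empty: "indep {}"
    and indep_subset: "indep X \<Longrightarrow> Y \<subseteq> X \<Longrightarrow> indep Y"
    and indep_augment:
      "indep X \<Longrightarrow> indep Y \<Longrightarrow> card X < card Y \<Longrightarrow> \<exists>y\<in>Y - X. indep (insert y X)"
begin

definition rank :: "'a set \<Rightarrow> nat" where
  "rank A = Max (card ` {X. X \<subseteq> A \<and> indep X})"

definition base :: "'a set \<Rightarrow> bool" where
  "base B \<longleftrightarrow> indep B \<and> (\<forall>X. indep X \<and> B \<subseteq> X \<longrightarrow> X = B)"

definition loopless :: bool where
  "loopless \<longleftrightarrow> (\<forall>e\<in>E. indep {e})"

end

text \<open>A cyclic ordering is represented by the list obtained by cutting the cycle open at an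
  arbitrary place; positions are 0-based and read modulo the length.\<close>

definition cyclic_ordering :: "'a set \<Rightarrow> 'a list \<Rightarrow> bool" where
  "cyclic_ordering E es \<longleftrightarrow> distinct es \<and> set es = E"

definition cyclically_consecutive :: "'a list \<Rightarrow> nat \<Rightarrow> nat \<Rightarrow> 'a set" where
  "cyclically_consecutive es k i = (\<lambda>j. es ! ((i + j) mod length es)) ` {..<k}"

end

theory Submission
  imports Defs
begin

text \<open>
  The theorem is a case of the theorem of van den Heuvel and Thomasse: if weights satisfy
  w(A) <= D r(A) for all A, then every element e can be given an arc of length w(e) on the cycle
  of integers modulo D so that the elements covering each point are independent. With D = |E| and
  all weights equal to r(M), every point is covered by a base, so the number of arcs starting at i
  equals the number starting at i - r(M); coprimality makes this number constantly 1, and the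
  starting points give the ordering.

  For the arcs, induct on the total weight. Lengthening one arc by 1 leaves at most one point t whose
  cover is dependent, and that cover contains a unique circuit. Some element of this circuit has its
  arc starting at t (otherwise the circuit also lies in the cover of t - 1); pushing the arc of the
  least advanced such element one step forward moves the defect. Suppose this never stops. Let A
  consist of the elements pushed infinitely often and let F(i) be the eventually fixed part of the
  cover of i. Covers keep their closure, so A stays spanned at every point, even
  using only F(i) \<inter> F(i - 1) from the fixed part. Hence r(A \<union> T) - |T| has the same value for
  T = F(i) and T = F(i) \<inter> F(i - 1), and does not depend on i; submodularity extends this to
  T = G, the intersection of all F(i), which consists of elements of weight D. Counting incidences then
  gives w(A \<union> G) > D r(A \<union> G), a contradiction.\<close>

section \<open>Periodic sequences and residues of integers\<close>

text \<open>Enough full periods added to \<open>j\<close> lead past \<open>i\<close>, so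
  monotonicity bounds \<open>f i\<close> by \<open>f j\<close>; the two points can be
  exchanged.\<close>

lemma periodic_mono_const:
  fixes f :: "int \<Rightarrow> nat"
  assumes mono: "\<And>i. f (i - 1) \<le> f i" and per: "\<And>i. f (i + int D) = f i" and "D > 0"
  shows "f i = f j"
proof -
  have up: "f i \<le> f (i + int k)" for i k
  proof (induction k)
    case (Suc k)
    thus ?case using mono[of "i + int (Suc k)"] by (simp add: algebra_simps)
  qed auto
  have per': "f (i + int (k * D)) = f i" for i k
  proof (induction k)
    case (Suc k)
    thus ?case using per[of "i + int (k * D)"] by (simp add: algebra_simps)
  qed auto
  have le: "f i \<le> f j" for i j
  proof -
    define k where "k = nat \<bar>i - j\<bar>"
    have "k \<le> k * D" using \<open>D > 0\<close> by auto
    hence "j + int (k * D) \<ge> i" unfolding k_def by linarith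
    hence "f i \<le> f (j + int (k * D))" using up[of i "nat (j + int (k * D) - i)"] by simp
    thus ?thesis using per' by simp
  qed
  show ?thesis using le[of i j] le[of j i] by simp
qed

lemma pred_mod_int:
  fixes D a :: int
  assumes "D > 0"
  shows "(a - 1) mod D = (if a mod D = 0 then D - 1 else a mod D - 1)"
proof (cases "a mod D = 0")
  case True
  have "a - 1 = D * (a div D - 1) + (D - 1)" using True mult_div_mod_eq[of D a]
    by (simp add: algebra_simps)
  hence "(a - 1) mod D = D - 1" by (rule int_mod_pos_eq) (use assms in auto)
  thus ?thesis using True by simp
next
  case False
  have "a - 1 = D * (a div D) + (a mod D - 1)" using mult_div_mod_eq[of D a] by simp
  moreover have "0 \<le> a mod D - 1" "a mod D - 1 < D"
    using assms False pos_mod_sign[of D a] pos_mod_bound[of D a] by linarith+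
  ultimately have "(a - 1) mod D = a mod D - 1" by (rule int_mod_pos_eq)
  thus ?thesis using False by simp
qed

lemma mod_diff_eq_iff:
  fixes D i t c :: int
  assumes "0 \<le> c" "c < D"
  shows "(i - (t + c)) mod D = 0 \<longleftrightarrow> (i - t) mod D = c"
  using mod_eq_dvd_iff[of "i - t" D c] assms by (simp add: mod_eq_0_iff_dvd algebra_simps)

section \<open>Rank, closure and the circuit of a repairable set\<close>

context matroid
begin

definition cl :: "'a set \<Rightarrow> 'a set" where
  "cl S = {x\<in>E. rank (insert x S) = rank S}"

text \<open>For dependent B this is the unique circuit in B when nonempty, and empty if B contains more
  than one circuit.\<close>

definition repair_set :: "'a set \<Rightarrow> 'a set" where
  "repair_set B = {x\<in>B. indep (B - {x})}"

lemma indep_finite: "indep X \<Longrightarrow> finite X"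
  using finite_ground finite_subset indep_subset_ground by blast

lemma finite_indep_subsets: "finite {X. X \<subseteq> A \<and> indep X}"
  by (rule finite_subset[of _ "Pow E"]) (use indep_subset_ground finite_ground in auto)

lemma card_le_rank: "indep X \<Longrightarrow> X \<subseteq> A \<Longrightarrow> card X \<le> rank A"
  unfolding rank_def using finite_indep_subsets by (intro Max_ge) auto

lemma rank_attained: obtains X where "X \<subseteq> A" "indep X" "card X = rank A"
proof -
  have "rank A \<in> card ` {X. X \<subseteq> A \<and> indep X}"
    unfolding rank_def using finite_indep_subsets indep_empty by (intro Max_in) auto
  thus ?thesis using that by auto
qed

lemma indep_extend:
  assumes "indep X" "X \<subseteq> A"
  obtains Y where "X \<subseteq> Y" "Y \<subseteq> A" "indep Y" "card Y = rank A"
proof -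
  have "\<exists>Y. X \<subseteq> Y \<and> Y \<subseteq> A \<and> indep Y \<and> card Y = rank A"
    using assms
  proof (induction "rank A - card X" arbitrary: X)
    case 0
    thus ?case using card_le_rank[of X A] by auto
  next
    case (Suc n)
    obtain Z where Z: "Z \<subseteq> A" "indep Z" "card Z = rank A" by (rule rank_attained)
    moreover have "card X < rank A" using Suc(2) by linarith
    ultimately obtain y where y: "y \<in> Z - X" "indep (insert y X)"
      using indep_augment[of X Z] Suc by auto
    have "n = rank A - card (insert y X)"
      using Suc y indep_finite[of X] by auto
    from Suc(1)[OF this y(2)] Suc y Z show ?case by auto
  qed
  thus ?thesis using that by auto
qed

lemma rank_mono: "A \<subseteq> B \<Longrightarrow> rank A \<le> rank B"
  by (metis card_le_rank order_trans rank_attained)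

lemma rank_indep: "indep X \<Longrightarrow> rank X = card X"
  by (metis card_le_rank card_mono indep_finite le_antisym order_refl rank_attained)

lemma rank_le_card: "finite A \<Longrightarrow> rank A \<le> card A"
  by (metis card_mono rank_attained)

lemma indep_if_card_le_rank: "finite X \<Longrightarrow> card X \<le> rank X \<Longrightarrow> indep X"
  by (metis card_seteq rank_attained)

lemma rank_submodular: "rank (X \<union> Y) + rank (X \<inter> Y) \<le> rank X + rank Y"
proof -
  obtain I where I: "I \<subseteq> X \<inter> Y" "indep I" "card I = rank (X \<inter> Y)" by (rule rank_attained)
  obtain J where J: "I \<subseteq> J" "J \<subseteq> X \<union> Y" "indep J" "card J = rank (X \<union> Y)"
    using indep_extend[of I "X \<union> Y"] I by auto
  have fin: "finite J" using J indep_finite by auto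
  have "card (J \<inter> X) + card (J \<inter> Y) = card (J \<inter> X \<union> J \<inter> Y) + card (J \<inter> X \<inter> (J \<inter> Y))"
    using fin by (intro card_Un_Int) auto
  moreover have "card (J \<inter> X \<union> J \<inter> Y) = card J" using J by (intro arg_cong[where f = card]) auto
  moreover have "card I \<le> card (J \<inter> X \<inter> (J \<inter> Y))"
    using I J fin by (intro card_mono) auto
  moreover have "card (J \<inter> X) \<le> rank X" "card (J \<inter> Y) \<le> rank Y"
    using J indep_subset by (auto intro!: card_le_rank)
  ultimately show ?thesis using I J by linarith
qed

lemma rank_Un_le: "finite Y \<Longrightarrow> rank (X \<union> Y) \<le> rank X + card Y"
  using rank_submodular[of X Y] rank_le_card[of Y] by linarith

lemma cl_mono:
  assumes "S \<subseteq> T" shows "cl S \<subseteq> cl T"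
proof
  fix x assume x: "x \<in> cl S"
  have "rank (T \<union> insert x S) + rank (T \<inter> insert x S) \<le> rank T + rank (insert x S)"
    by (rule rank_submodular)
  moreover have "T \<union> insert x S = insert x T" using assms by auto
  moreover have "rank S \<le> rank (T \<inter> insert x S)" using assms by (intro rank_mono) auto
  moreover have "rank T \<le> rank (insert x T)" by (rule rank_mono) auto
  ultimately show "x \<in> cl T" using x by (auto simp: cl_def)
qed

lemma cl_extensive: "S \<subseteq> E \<Longrightarrow> S \<subseteq> cl S"
  by (auto simp: cl_def insert_absorb)

lemma cl_subset: "cl S \<subseteq> E"
  by (auto simp: cl_def)

lemma rank_Un_cl:
  assumes "S \<subseteq> cl T" shows "rank (S \<union> T) = rank T"
proof -
  have "finite S" using assms cl_subset finite_ground finite_subset by (meson order_trans)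
  thus ?thesis using assms
  proof induction
    case (insert x S)
    have "x \<in> cl (S \<union> T)" using insert cl_mono[of T "S \<union> T"] by auto
    thus ?case using insert by (auto simp: cl_def)
  qed auto
qed

lemma cl_subset_cl:
  assumes "S \<subseteq> cl T" shows "cl S \<subseteq> cl T"
proof
  fix x assume "x \<in> cl S"
  hence x: "x \<in> cl (S \<union> T)" using cl_mono[of S "S \<union> T"] by auto
  have "rank (insert x T) \<le> rank (insert x (S \<union> T))" by (rule rank_mono) auto
  also have "\<dots> = rank T" using x rank_Un_cl[OF assms] by (auto simp: cl_def)
  finally show "x \<in> cl T"
    using x rank_mono[OF subset_insertI[of T x]] by (auto simp: cl_def)
qed

lemma cl_insert_eq:
  assumes "x \<in> cl S" "S \<subseteq> E" shows "cl (insert x S) = cl S"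
  using assms cl_subset_cl[of "insert x S" S] cl_extensive[of S] cl_mono[of S "insert x S"] by auto

text \<open>Since one deletion makes \<open>B\<close> independent, \<open>rank B\<close> is
  \<open>card B - 1\<close>. If \<open>Z\<close> were independent, a largest independent set between
  \<open>Z\<close> and \<open>B\<close> would miss exactly one element, which would then lie in
  \<open>repair_set B\<close> but not in \<open>Z\<close>.\<close>

lemma dependent_superset_repair_set:
  assumes "finite B" "\<not> indep B" "repair_set B \<noteq> {}" "repair_set B \<subseteq> Z" "Z \<subseteq> B"
  shows "\<not> indep Z"
proof
  assume Z: "indep Z"
  obtain x where x: "x \<in> B" "indep (B - {x})" using assms by (auto simp: repair_set_def)
  obtain J where J: "Z \<subseteq> J" "J \<subseteq> B" "indep J" "card J = rank B"
    using indep_extend[OF Z assms(5)] by auto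
  have "J \<noteq> B" using J assms by auto
  then obtain z where z: "z \<in> B - J" using J by auto
  have "card (B - {x}) \<le> card J" unfolding J(4) using x by (intro card_le_rank) auto
  hence "card (B - {z}) \<le> card J" using x z assms(1) by auto
  moreover have "J \<subseteq> B - {z}" using J z by auto
  ultimately have "J = B - {z}" using assms(1) by (intro card_seteq) auto
  hence "z \<in> repair_set B" using J z by (auto simp: repair_set_def)
  thus False using z J assms by auto
qed

text \<open>\<open>Z\<close> contains the circuit and is dependent, while \<open>Z - {x}\<close> is
  independent, so \<open>x\<close> adds no rank. That \<open>Z\<close> may omit elements off the
  circuit lets closures be tracked with only part of a cover.\<close>

lemma repair_set_cl:
  assumes "finite B" "B \<subseteq> E" "\<not> indep B" "x \<in> repair_set B" "repair_set B \<subseteq> Z" "Z \<subseteq> B"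
  shows "x \<in> cl (Z - {x})"
proof -
  have dep: "\<not> indep Z" using dependent_superset_repair_set[of B Z] assms by auto
  have fin: "finite Z" using assms(1,6) finite_subset by auto
  have xZ: "x \<in> Z" "x \<in> E" using assms by (auto simp: repair_set_def)
  have "indep (Z - {x})"
    using assms indep_subset[of "B - {x}" "Z - {x}"] by (auto simp: repair_set_def)
  hence "rank (Z - {x}) = card Z - 1" using rank_indep xZ fin by auto
  moreover have "rank Z < card Z" using indep_if_card_le_rank[OF fin] dep by linarith
  moreover have "rank (Z - {x}) \<le> rank Z" by (rule rank_mono) auto
  ultimately have "rank (Z - {x}) = rank Z" by linarith
  thus ?thesis using xZ by (auto simp: cl_def insert_absorb)
qed

section \<open>Rank minus size over a fixed set\<close>

text \<open>The excess \<open>rank (A \<union> X) - card X\<close> is submodular in \<open>X\<close>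
  and never grows with \<open>X\<close>. So it is at least \<open>a\<close> on
  \<open>S \<union> T\<close>, which lies inside \<open>U\<close>; hence at most \<open>a\<close> on
  \<open>S \<inter> T\<close> by submodularity, and at least \<open>a\<close> there because
  \<open>S\<close> is larger.\<close>

lemma rank_excess_Int:
  assumes fin: "finite U" and "S \<subseteq> U" "T \<subseteq> U"
    and S: "rank (A \<union> S) = a + card S" and T: "rank (A \<union> T) = a + card T"
    and U: "rank (A \<union> U) = a + card U"
  shows "rank (A \<union> (S \<inter> T)) = a + card (S \<inter> T)"
proof -
  have fins: "finite S" "finite T" using assms finite_subset by auto
  have "(A \<union> S) \<union> (A \<union> T) = A \<union> (S \<union> T)" "(A \<union> S) \<inter> (A \<union> T) = A \<union> (S \<inter> T)" by auto
  hence "rank (A \<union> (S \<union> T)) + rank (A \<union> (S \<inter> T)) \<le> rank (A \<union> S) + rank (A \<union> T)"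
    using rank_submodular[of "A \<union> S" "A \<union> T"] by simp
  moreover have "rank (A \<union> U) \<le> rank (A \<union> (S \<union> T)) + card (U - (S \<union> T))"
    using rank_Un_le[of "U - (S \<union> T)" "A \<union> (S \<union> T)"] fin assms(2,3)
    by (simp add: Un_assoc Un_absorb1 Un_absorb2)
  moreover have "card U = card (S \<union> T) + card (U - (S \<union> T))"
    using fin assms(2,3) by (metis Un_least card_mono card_Diff_subset finite_subset
        le_add_diff_inverse)
  moreover have "card S + card T = card (S \<union> T) + card (S \<inter> T)" using fins by (rule card_Un_Int)
  moreover have "rank (A \<union> S) \<le> rank (A \<union> (S \<inter> T)) + card (S - T)"
  proof -
    have "A \<union> (S \<inter> T) \<union> (S - T) = A \<union> S" by auto
    thus ?thesis using rank_Un_le[of "S - T" "A \<union> (S \<inter> T)"] fins by simp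
  qed
  moreover have "card S = card (S \<inter> T) + card (S - T)"
    using fins by (metis Int_Diff_Un Int_Diff_disjoint card_Un_disjoint finite_Diff finite_Int)
  ultimately show ?thesis using S T U by linarith
qed

text \<open>Between \<open>F i \<inter> F (i - 1)\<close> and \<open>F i\<close> the excess over
  \<open>A\<close> is \<open>card (J i)\<close>, because \<open>J i\<close> and the smaller set
  already span \<open>A\<close>. The smaller set also lies in \<open>F (i - 1)\<close>, whose excess
  is \<open>card (J (i - 1))\<close>, so \<open>card (J i)\<close> weakly increases with
  \<open>i\<close> and is constant by periodicity. Longer intersections follow by
  \<open>rank_excess_Int\<close>.\<close>

lemma rank_excess_cyclic_Inter:
  fixes F J :: "int \<Rightarrow> 'a set"
  assumes "D > 0" and A: "A \<subseteq> E"
    and FE: "\<And>i. F i \<subseteq> E - A" and JA: "\<And>i. J i \<subseteq> A"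
    and perF: "\<And>i. F (i + int D) = F i" and perJ: "\<And>i. J (i + int D) = J i"
    and ind: "\<And>i. indep (J i \<union> F i)"
    and spn: "\<And>i. A \<subseteq> cl (J i \<union> (F i \<inter> F (i - 1)))"
  shows "rank (A \<union> (\<Inter>i. F i)) = card (J k) + card (\<Inter>i. F i)"
proof -
  have fin: "finite (F i)" "finite (J i)" for i
    using FE JA A finite_ground by (meson Diff_subset finite_subset order_trans)+
  have excess: "rank (A \<union> T) = card (J i) + card T" if T: "F i \<inter> F (i - 1) \<subseteq> T" "T \<subseteq> F i" for i T
  proof -
    have "indep (J i \<union> T)" using ind[of i] T by (auto intro: indep_subset)
    moreover have "A \<subseteq> cl (J i \<union> T)" using spn[of i] cl_mono[of _ "J i \<union> T"] T
      by (meson Un_mono order_refl order_trans)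
    hence "rank (A \<union> (J i \<union> T)) = rank (J i \<union> T)" by (rule rank_Un_cl)
    moreover have "A \<union> (J i \<union> T) = A \<union> T" using JA by auto
    moreover have "card (J i \<union> T) = card (J i) + card T"
      using fin T JA[of i] FE[of i] by (intro card_Un_disjoint) (auto intro: finite_subset)
    ultimately show ?thesis using rank_indep by metis
  qed
  have "card (J (i - 1)) \<le> card (J i)" for i
  proof -
    let ?H = "F i \<inter> F (i - 1)"
    have "rank (A \<union> F (i - 1)) = card (J (i - 1)) + card (F (i - 1))"
      by (rule excess) auto
    moreover have "rank (A \<union> ?H) = card (J i) + card ?H"
      by (rule excess) auto
    moreover have "rank (A \<union> F (i - 1)) \<le> rank (A \<union> ?H) + card (F (i - 1) - F i)"
    proof -
      have "A \<union> ?H \<union> (F (i - 1) - F i) = A \<union> F (i - 1)" by auto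
      thus ?thesis using rank_Un_le[of "F (i - 1) - F i" "A \<union> ?H"] fin by simp
    qed
    moreover have "card (F (i - 1)) = card ?H + card (F (i - 1) - F i)"
      using fin by (metis Int_Diff_Un Int_Diff_disjoint Int_commute card_Un_disjoint finite_Diff finite_Int)
    ultimately show ?thesis by linarith
  qed
  hence const: "card (J i) = card (J k)" for i
    using periodic_mono_const[of "\<lambda>i. card (J i)" D] perJ \<open>D > 0\<close> by metis
  define T where "T i n = (\<Inter>j\<in>{..n::nat}. F (i - int j))" for i n
  have T: "rank (A \<union> T i n) = card (J k) + card (T i n)" for i n
  proof (induction n arbitrary: i)
    case 0
    thus ?case using excess[of i "F i"] const by (simp add: T_def)
  next
    case (Suc n)
    show ?case
    proof (cases n)
      case 0
      have "T i (Suc n) = F i \<inter> F (i - 1)" using 0 by (auto simp: T_def atMost_Suc)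
      thus ?thesis using excess[of i "F i \<inter> F (i - 1)"] const by simp
    next
      case (Suc m)
      \<comment> \<open>Two runs of equal length, shifted by one. For positive \<open>n\<close> both
        lie in \<open>F (i - 1)\<close>, which is taken as the common superset
        \<open>U\<close>.\<close>
      have "T i (Suc n) = T i n \<inter> T (i - 1) n"
      proof -
        have eq: "{..Suc n} = {..n} \<union> Suc ` {..n}"
          by (auto simp: image_iff le_Suc_eq)
        show ?thesis unfolding T_def eq INT_Un by (simp add: algebra_simps)
      qed
      moreover have "T i n \<subseteq> F (i - 1)"
        unfolding T_def using Suc by (intro INF_lower2[of 1]) auto
      moreover have "T (i - 1) n \<subseteq> F (i - 1)"
        unfolding T_def by (intro INF_lower2[of 0]) auto
      moreover have "rank (A \<union> F (i - 1)) = card (J k) + card (F (i - 1))"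
        using excess[of "i - 1" "F (i - 1)"] const by simp
      ultimately show ?thesis
        using rank_excess_Int[of "F (i - 1)" "T i n" "T (i - 1) n"] fin Suc.IH by simp
    qed
  qed
  have "T 0 D = (\<Inter>i. F i)"
  proof
    have per': "F (i + int m * int D) = F i" for i m
    proof (induction m)
      case (Suc m)
      thus ?case using perF[of "i + int m * int D"] by (simp add: algebra_simps)
    qed auto
    have "F i \<supseteq> T 0 D" for i
    proof -
      \<comment> \<open>The point \<open>- int j\<close>, one of those in the run
        \<open>T 0 D\<close>, is congruent to \<open>i\<close>; \<open>q\<close> counts the periods
        between them and may have either sign.\<close>
      define j q where "j = nat ((- i) mod int D)" and "q = - ((- i) div int D)"
      have j: "int j = (- i) mod int D" using \<open>D > 0\<close> by (simp add: j_def)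
      hence "j \<le> D" using \<open>D > 0\<close> pos_mod_bound[of "int D" "- i"] by linarith
      have q: "i + int j = int D * q"
        using mult_div_mod_eq[of "int D" "- i"] unfolding j q_def mult_minus_right by linarith
      have "F i = F (- int j)"
      proof (cases "q \<ge> 0")
        case True
        moreover have "i = - int j + q * int D" using q by (simp add: algebra_simps)
        ultimately show ?thesis using per'[of "- int j" "nat q"] by simp
      next
        case False
        hence "i + int (nat (- q)) * int D = - int j" using q by (simp add: algebra_simps)
        thus ?thesis using per'[of i "nat (- q)"] by simp
      qed
      thus ?thesis using \<open>j \<le> D\<close> by (auto simp: T_def)
    qed
    thus "T 0 D \<subseteq> (\<Inter>i. F i)" by auto
  qed (auto simp: T_def)
  thus ?thesis using T by metis
qed


section \<open>Arcs on the cycle and their covers\<close>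

text \<open>The elements whose arc covers the point i, where the arc of e has length w e and starts at
  s e. Starting points are integers, not residues, so that they also record how often
  an arc has been pushed.\<close>

definition arcs :: "nat \<Rightarrow> ('a \<Rightarrow> nat) \<Rightarrow> ('a \<Rightarrow> int) \<Rightarrow> int \<Rightarrow> 'a set" where
  "arcs D w s i = {e\<in>E. (i - s e) mod int D < int (w e)}"

lemma arcs_in_ground: "x \<in> arcs D w s i \<Longrightarrow> x \<in> E"
  by (simp add: arcs_def)

lemma arcs_subset: "arcs D w s i \<subseteq> E"
  by (auto simp: arcs_def)

lemma finite_arcs: "finite (arcs D w s i)"
  by (rule finite_subset[OF arcs_subset finite_ground])

lemma arcs_cong:
  assumes "(i - j) mod int D = 0" shows "arcs D w s i = arcs D w s j"
proof -
  have "int D dvd i - j" using assms by (rule mod_0_imp_dvd)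
  hence "(i - s e) mod int D = (j - s e) mod int D" for e
    by (simp add: mod_eq_dvd_iff)
  thus ?thesis by (simp add: arcs_def)
qed

text \<open>One step back lowers the offset of a point in an arc by 1, except that offset 0 wraps to
  \<open>D - 1\<close>. Only this wrap can leave the arc, and only if the arc is not the full
  cycle.\<close>

lemma arcs_start:
  assumes "D > 0" "x \<in> arcs D w s t" "x \<notin> arcs D w s (t - 1)"
  shows "(t - s x) mod int D = 0" "0 < w x" "w x < D"
proof -
  define m where "m = (t - s x) mod int D"
  have m: "0 \<le> m" "m < int (w x)" using assms(1,2) by (simp_all add: arcs_def m_def)
  have "(t - 1 - s x) mod int D = (if m = 0 then int D - 1 else m - 1)"
    using pred_mod_int[of "int D" "t - s x"] assms(1) unfolding m_def by (simp only: diff_right_commute of_nat_0_less_iff)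
  hence "\<not> (if m = 0 then int D - 1 else m - 1) < int (w x)"
    using assms(2,3) by (simp add: arcs_def)
  hence "m = 0 \<and> 0 < w x \<and> w x < D" using m by (simp split: if_splits)
  thus "(t - s x) mod int D = 0" "0 < w x" "w x < D" unfolding m_def by blast+
qed

text \<open>\<open>t\<close> is the first point of the arc and \<open>t + w x\<close> the first one
  past its end; the bounds on \<open>w x\<close> keep them apart modulo \<open>D\<close>.\<close>

lemma arcs_push:
  assumes "D > 0" "x \<in> E" and t: "(t - s x) mod int D = 0" and w: "0 < w x" "w x < D"
  shows "arcs D w (s(x := s x + 1)) i =
     (if (i - t) mod int D = 0 then arcs D w s i - {x}
      else if (i - t) mod int D = int (w x) then insert x (arcs D w s i) else arcs D w s i)"
    and "(i - t) mod int D = 0 \<Longrightarrow> x \<in> arcs D w s i"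
    and "(i - t) mod int D = int (w x) \<Longrightarrow> x \<notin> arcs D w s i"
proof -
  have m: "(i - s x) mod int D = (i - t) mod int D"
  proof -
    have "int D dvd t - s x" using t by (rule mod_0_imp_dvd)
    thus ?thesis by (simp add: mod_eq_dvd_iff)
  qed
  have p: "(i - (s x + 1)) mod int D = (if (i - t) mod int D = 0 then int D - 1 else (i - t) mod int D - 1)"
    using pred_mod_int[of "int D" "i - s x"] assms(1) m by (simp add: algebra_simps)
  have "y \<in> arcs D w (s(x := s x + 1)) i \<longleftrightarrow> y \<in> 
     (if (i - t) mod int D = 0 then arcs D w s i - {x}
      else if (i - t) mod int D = int (w x) then insert x (arcs D w s i) else arcs D w s i)" for y
    using w p m assms(2) by (cases "y = x") (auto simp: arcs_def)
  thus "arcs D w (s(x := s x + 1)) i =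
     (if (i - t) mod int D = 0 then arcs D w s i - {x}
      else if (i - t) mod int D = int (w x) then insert x (arcs D w s i) else arcs D w s i)"
    by blast
  show "(i - t) mod int D = 0 \<Longrightarrow> x \<in> arcs D w s i"
    "(i - t) mod int D = int (w x) \<Longrightarrow> x \<notin> arcs D w s i"
    using w m assms(2) by (auto simp: arcs_def)
qed

text \<open>Double counting: an arc of length at most \<open>D\<close> meets any \<open>D\<close>
  consecutive points in exactly its length many. The bijection sends a point to its offset in the
  arc.\<close>

lemma sum_card_arcs:
  assumes "D > 0" "A \<subseteq> E" "\<And>e. e \<in> A \<Longrightarrow> w e \<le> D"
  shows "(\<Sum>i<D. card (arcs D w s (c + int i) \<inter> A)) = (\<Sum>e\<in>A. w e)"
proof -
  have finA: "finite A" using assms finite_ground finite_subset by blast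
  have cnt: "card {i\<in>{..<D}. (c + int i - s e) mod int D < int (w e)} = w e" if e: "e \<in> A" for e
  proof -
    have "bij_betw (\<lambda>i. nat ((c + int i - s e) mod int D)) {i\<in>{..<D}. (c + int i - s e) mod int D < int (w e)} {..<w e}"
    proof (rule bij_betw_byWitness[where f' = "\<lambda>j. nat ((int j + s e - c) mod int D)"])
      show "\<forall>i\<in>{i\<in>{..<D}. (c + int i - s e) mod int D < int (w e)}.
         nat ((int (nat ((c + int i - s e) mod int D)) + s e - c) mod int D) = i"
      proof
        fix i assume i: "i \<in> {i\<in>{..<D}. (c + int i - s e) mod int D < int (w e)}"
        have "((c + int i - s e) mod int D + (s e - c)) mod int D = (c + int i - s e + (s e - c)) mod int D"
          by (rule mod_add_left_eq)
        thus "nat ((int (nat ((c + int i - s e) mod int D)) + s e - c) mod int D) = i"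
          using i assms(1) by (simp add: algebra_simps)
      qed
      have inv: "(c + int (nat ((int j + s e - c) mod int D)) - s e) mod int D = int j" if "j < w e" for j
      proof -
        have "((int j + s e - c) mod int D + (c - s e)) mod int D = (int j + s e - c + (c - s e)) mod int D"
          by (rule mod_add_left_eq)
        moreover have "j < D" using that assms(3)[OF e] by simp
        ultimately show ?thesis using assms(1) by (simp add: algebra_simps)
      qed
      thus "\<forall>j\<in>{..<w e}. nat ((c + int (nat ((int j + s e - c) mod int D)) - s e) mod int D) = j"
        by simp
      show "(\<lambda>i. nat ((c + int i - s e) mod int D)) ` {i\<in>{..<D}. (c + int i - s e) mod int D < int (w e)} \<subseteq> {..<w e}"
        using assms(1) by (auto simp: nat_less_iff)
      show "(\<lambda>j. nat ((int j + s e - c) mod int D)) ` {..<w e} \<subseteq> {i\<in>{..<D}. (c + int i - s e) mod int D < int (w e)}"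
        using inv assms(1) by (auto simp: nat_less_iff)
    qed
    from bij_betw_same_card[OF this] show ?thesis by simp
  qed
  have "(\<Sum>i<D. card (arcs D w s (c + int i) \<inter> A)) =
      (\<Sum>i<D. \<Sum>e\<in>A. if (c + int i - s e) mod int D < int (w e) then 1 else 0)"
  proof (intro sum.cong refl)
    fix i
    have "arcs D w s (c + int i) \<inter> A = {e\<in>A. (c + int i - s e) mod int D < int (w e)}"
      using assms(2) by (auto simp: arcs_def)
    thus "card (arcs D w s (c + int i) \<inter> A) = (\<Sum>e\<in>A. if (c + int i - s e) mod int D < int (w e) then 1 else 0)"
      using finA by (simp add: sum.If_cases Int_def)
  qed
  also have "\<dots> = (\<Sum>e\<in>A. \<Sum>i<D. if (c + int i - s e) mod int D < int (w e) then 1 else 0)"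
    by (rule sum.swap)
  also have "\<dots> = (\<Sum>e\<in>A. w e)"
  proof (intro sum.cong refl)
    fix e assume e: "e \<in> A"
    show "(\<Sum>i<D. if (c + int i - s e) mod int D < int (w e) then 1 else 0) = w e"
      using cnt[OF e] by (simp add: sum.If_cases Int_def)
  qed
  finally show ?thesis .
qed


section \<open>Pushing the defect around the cycle\<close>

text \<open>The last two conjuncts say that the cover of \<open>t\<close> contains exactly one
  circuit.\<close>

definition one_defect :: "nat \<Rightarrow> ('a \<Rightarrow> nat) \<Rightarrow> ('a \<Rightarrow> int) \<Rightarrow> int \<Rightarrow> bool" where
  "one_defect D w s t \<longleftrightarrow> (\<forall>i. (i - t) mod int D \<noteq> 0 \<longrightarrow> indep (arcs D w s i)) \<and>
     \<not> indep (arcs D w s t) \<and> repair_set (arcs D w s t) \<noteq> {}"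

text \<open>Otherwise the circuit would lie in the cover of \<open>t - 1\<close>, which is
  independent, as \<open>D \<ge> 2\<close> makes \<open>t - 1\<close> a different point of the
  cycle.\<close>

lemma one_defect_starting_element:
  assumes "D \<ge> 2" "one_defect D w s t"
  shows "\<exists>x\<in>repair_set (arcs D w s t). x \<notin> arcs D w s (t - 1)"
proof (rule ccontr)
  assume "\<not> ?thesis"
  hence sub: "repair_set (arcs D w s t) \<subseteq> arcs D w s (t - 1)" by auto
  have "(t - 1 - t) mod int D \<noteq> 0" using assms(1) by (simp add: zmod_minus1)
  hence "indep (arcs D w s (t - 1))" using assms(2) by (auto simp: one_defect_def)
  hence "indep (repair_set (arcs D w s t))" using sub indep_subset by blast
  thus False
    using dependent_superset_repair_set[of "arcs D w s t" "repair_set (arcs D w s t)"] assms(2) finite_arcs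
    by (auto simp: one_defect_def repair_set_def)
qed

lemma repair_set_subset: "repair_set B \<subseteq> B"
  by (auto simp: repair_set_def)

text \<open>Taking \<open>x\<close> off its circuit repairs \<open>t\<close>, and the only cover
  that grows is that of \<open>t + w x\<close>. It was independent before it received
  \<open>x\<close>, so removing \<open>x\<close> again repairs it.\<close>

lemma one_defect_push:
  assumes "D \<ge> 2" and def: "one_defect D w s t" and x: "x \<in> repair_set (arcs D w s t)"
    and start: "x \<notin> arcs D w s (t - 1)"
    and dep: "\<exists>i. \<not> indep (arcs D w (s(x := s x + 1)) i)"
  shows "one_defect D w (s(x := s x + 1)) (t + int (w x))"
    and "x \<in> repair_set (arcs D w (s(x := s x + 1)) (t + int (w x)))"
proof -
  let ?s = "s(x := s x + 1)" and ?t = "t + int (w x)"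
  have xt: "x \<in> arcs D w s t" using x repair_set_subset by auto
  have D: "D > 0" using assms by auto
  note st = arcs_start[OF D xt start]
  have xE: "x \<in> E" using xt by (rule arcs_in_ground)
  note push = arcs_push[where s = s and x = x and t = t and w = w, OF D xE st]
  have iff: "(i - ?t) mod int D = 0 \<longleftrightarrow> (i - t) mod int D = int (w x)" for i
    using mod_diff_eq_iff[of "int (w x)" "int D"] st by simp
  have ok: "indep (arcs D w ?s i)" if "(i - ?t) mod int D \<noteq> 0" for i
  proof (cases "(i - t) mod int D = 0")
    case True
    hence "arcs D w s i = arcs D w s t" by (rule arcs_cong)
    thus ?thesis using push(1)[of i] True x by (auto simp: repair_set_def)
  next
    case False
    thus ?thesis using push(1)[of i] that iff def by (auto simp: one_defect_def)
  qed
  have t': "(?t - t) mod int D = int (w x)" using st by simp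
  hence "arcs D w ?s ?t = insert x (arcs D w s ?t)" "x \<notin> arcs D w s ?t"
    using push(1,3)[of ?t] st by auto
  moreover have "indep (arcs D w s ?t)" using def t' st by (auto simp: one_defect_def)
  ultimately show xc: "x \<in> repair_set (arcs D w ?s ?t)" by (auto simp: repair_set_def)
  obtain i where i: "\<not> indep (arcs D w ?s i)" using dep by auto
  hence "(i - ?t) mod int D = 0" using ok by auto
  hence "\<not> indep (arcs D w ?s ?t)" using i arcs_cong by metis
  thus "one_defect D w ?s ?t" using ok xc by (auto simp: one_defect_def)
qed

text \<open>Elements pushed forever eventually run ahead of all others. Then, by the choice of a
  least advanced element, the other elements of a circuit never start at the defect.\<close>

lemma no_endless_pushing:
  fixes s :: "nat \<Rightarrow> 'a \<Rightarrow> int" and t :: "nat \<Rightarrow> int" and x :: "nat \<Rightarrow> 'a"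
  assumes D: "D \<ge> 2"
    and cond: "\<And>A. A \<subseteq> E \<Longrightarrow> (\<Sum>e\<in>A. w e) \<le> D * rank A"
    and def: "\<And>n. one_defect D w (s n) (t n)"
    and x: "\<And>n. x n \<in> repair_set (arcs D w (s n) (t n))"
    and start: "\<And>n. x n \<notin> arcs D w (s n) (t n - 1)"
    and least: "\<And>n y. y \<in> repair_set (arcs D w (s n) (t n)) \<Longrightarrow> y \<notin> arcs D w (s n) (t n - 1)
        \<Longrightarrow> s n (x n) \<le> s n y"
    and s_Suc: "\<And>n. s (Suc n) = (s n)(x n := s n (x n) + 1)"
    and t_Suc: "\<And>n. t (Suc n) = t n + int (w (x n))"
  shows False
proof -
  have D0: "D > 0" using D by auto
  have xt: "x n \<in> arcs D w (s n) (t n)" for n using x repair_set_subset by auto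
  have xE: "x n \<in> E" for n using xt by (rule arcs_in_ground)
  note st = arcs_start[OF D0 xt start]
  have push: "arcs D w (s (Suc n)) i =
     (if (i - t n) mod int D = 0 then arcs D w (s n) i - {x n}
      else if (i - t n) mod int D = int (w (x n)) then insert (x n) (arcs D w (s n) i)
      else arcs D w (s n) i)"
    "(i - t n) mod int D = 0 \<Longrightarrow> x n \<in> arcs D w (s n) i"
    "(i - t n) mod int D = int (w (x n)) \<Longrightarrow> x n \<notin> arcs D w (s n) i" for i n
    using arcs_push[where s = "s n" and x = "x n" and t = "t n" and w = w, OF D0 xE st] s_Suc
    by metis+
  define A where "A = {e. infinite {n. x n = e}}"
  have xA_wE: "e \<in> E \<and> 0 < w e" if "e \<in> A" for e
  proof -
    have "infinite {n. x n = e}" using that by (simp add: A_def)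
    hence "{n. x n = e} \<noteq> {}" using finite.emptyI by metis
    thus ?thesis using xE st(2) by auto
  qed
  hence AE: "A \<subseteq> E" by auto
  have finA: "finite A" using AE finite_ground finite_subset by auto

  have "\<forall>\<^sub>F n in sequentially. \<forall>e\<in>E - A. x n \<noteq> e"
  proof (intro eventually_ball_finite ballI)
    fix e assume "e \<in> E - A"
    hence "finite {n. \<not> x n \<noteq> e}" by (simp add: A_def)
    thus "\<forall>\<^sub>F n in sequentially. x n \<noteq> e"
      by (simp only: eventually_cofinite flip: cofinite_eq_sequentially)
  qed (use finite_ground in auto)
  then obtain M where M: "x n \<in> A" if "n \<ge> M" for n
    using xE by (auto simp: eventually_sequentially)

  have const: "s (m + k) y = s m y" if "\<And>j. j < k \<Longrightarrow> x (m + j) \<noteq> y" for m k y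
    using that by (induction k) (auto simp: s_Suc)
  have mono: "s m e \<le> s n e" if "m \<le> n" for m n e
    using that by (induction rule: dec_induct) (auto simp: s_Suc)
  \<comment> \<open>Starts rise in single steps and that of \<open>e\<close> rises forever, so no
    value is skipped.\<close>
  have hits: "\<exists>n\<ge>m. s n e = c" if e: "e \<in> A" and "s m e \<le> c" for e m c
    using that(2)
  proof (induction c rule: int_ge_induct)
    case base
    thus ?case by auto
  next
    case (step c)
    then obtain n where n: "n \<ge> m" "s n e = c" by auto
    have "\<exists>k\<ge>n. x k = e"
      using e by (auto simp: A_def finite_nat_set_iff_bounded not_less)
    hence "\<exists>k. x (n + k) = e" by (metis le_iff_add)
    hence "x (n + (LEAST k. x (n + k) = e)) = e" by (rule LeastI_ex)
    moreover have "s (n + (LEAST k. x (n + k) = e)) e = s n e"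
      by (rule const) (use not_less_Least in blast)
    ultimately have "s (Suc (n + (LEAST k. x (n + k) = e))) e = c + 1"
      using n s_Suc by simp
    thus ?case using n by (meson le_Suc_eq le_add1 order_trans)
  qed

  \<comment> \<open>A strict upper bound for the final starts outside \<open>A\<close>; the inserted
    0 only keeps \<open>Max\<close> off the empty set.\<close>
  define c where "c = Max (insert 0 (s M ` (E - A))) + 1"
  have c: "s M y < c" if "y \<in> E - A" for y
  proof -
    have "s M y \<le> Max (insert 0 (s M ` (E - A)))" using that finite_ground by (intro Max_ge) auto
    thus ?thesis by (simp add: c_def)
  qed
  have "\<forall>\<^sub>F n in sequentially. \<forall>a\<in>A. c \<le> s n a"
  proof (intro eventually_ball_finite ballI finA)
    fix a assume "a \<in> A"
    then obtain n where "s n a = max c (s 0 a)" using hits[of a 0 "max c (s 0 a)"] by auto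
    hence "c \<le> s k a" if "k \<ge> n" for k using mono[OF that, of a] by simp
    thus "\<forall>\<^sub>F n in sequentially. c \<le> s n a" by (auto simp: eventually_sequentially)
  qed
  then obtain N' where N': "c \<le> s n a" if "n \<ge> N'" "a \<in> A" for n a
    by (auto simp: eventually_sequentially)
  define N where "N = max M N'"
  have xA: "x n \<in> A" if "n \<ge> N" for n using M that by (simp add: N_def)
  have fixM: "s n y = s M y" if "n \<ge> M" "y \<notin> A" for n y
    using const[of "n - M" M y] M that by (metis le_add1 le_add_diff_inverse)
  have fixN: "s n y = s N y" if "n \<ge> N" "y \<notin> A" for n y
    using fixM[of n y] fixM[of N y] that by (simp add: N_def)
  have far: "s n y < s n a" if "n \<ge> N" "y \<in> E - A" "a \<in> A" for n y a
    using c[of y] N'[of n a] fixM[of n y] that by (simp add: N_def)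

  define F where "F i = arcs D w (s N) i - A" for i
  have F: "arcs D w (s n) i - A = F i" if "n \<ge> N" for n i
    using fixN[OF that] by (auto simp: F_def arcs_def)
  define H where "H i = F i \<inter> F (i - 1)" for i
  have F_cong: "F i = F j" if "(i - j) mod int D = 0" for i j
    using arcs_cong[OF that] by (simp add: F_def)
  have H_cong: "H i = H j" if "(i - j) mod int D = 0" for i j
    using F_cong[OF that] F_cong[of "i - 1" "j - 1"] that by (simp add: H_def)
  \<comment> \<open>Of the fixed elements only those covering both \<open>i\<close> and
    \<open>i - 1\<close> are kept; by \<open>circuit\<close> below, the circuit of every defect from
    \<open>N\<close> on still lies in this set.\<close>
  define Z where "Z n i = (arcs D w (s n) i \<inter> A) \<union> H i" for n i
  have ZE: "Z n i \<subseteq> E" for n i using arcs_in_ground by (auto simp: Z_def H_def F_def)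
  have HA: "H i \<inter> A = {}" for i by (auto simp: H_def F_def)
  have Zarcs: "Z n i \<subseteq> arcs D w (s n) i" if "n \<ge> N" for n i
    using F[OF that] by (auto simp: Z_def H_def)
  have circuit: "repair_set (arcs D w (s n) (t n)) \<subseteq> Z n (t n)" if n: "n \<ge> N" for n
  proof
    fix y assume y: "y \<in> repair_set (arcs D w (s n) (t n))"
    hence yt: "y \<in> arcs D w (s n) (t n)" using repair_set_subset by auto
    show "y \<in> Z n (t n)"
    proof (cases "y \<in> A")
      case False
      \<comment> \<open>The fixed element \<open>y\<close> is less advanced than \<open>x n\<close>;
        had it started at the defect, \<open>least\<close> would be violated.\<close>
      hence "s n y < s n (x n)" using far[OF n _ xA[OF n]] arcs_in_ground[OF yt] by auto
      hence "y \<in> arcs D w (s n) (t n - 1)" using least[OF y] by fastforce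
      thus ?thesis using yt False F[OF n] by (auto simp: Z_def H_def)
    qed (use yt in \<open>simp add: Z_def\<close>)
  qed
  have x_cl: "y \<in> cl (Z n i - {y})"
    if "n \<ge> N" "(i - t n) mod int D = 0" "y \<in> repair_set (arcs D w (s n) (t n))" for y n i
  proof -
    have "Z n i = Z n (t n)" using arcs_cong[OF that(2)] H_cong[OF that(2)] by (simp add: Z_def)
    thus ?thesis
      using repair_set_cl[OF finite_arcs arcs_subset _ that(3) circuit[OF that(1)] Zarcs[OF that(1)]]
        def[of n] by (simp add: one_defect_def)
  qed
  have xH: "x n \<notin> H i" if "n \<ge> N" for n i using xA[OF that] HA by auto
  have Z_push0: "Z (Suc n) i = Z n i - {x n}" "x n \<in> Z n i"
    if "n \<ge> N" "(i - t n) mod int D = 0" for n i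
    using push(1)[of n i] push(2)[of i n] that xH[OF that(1)] xA[OF that(1)] by (auto simp: Z_def)
  \<comment> \<open>Losing \<open>x n\<close> at \<open>t n\<close> is harmless because the rest of
    the circuit spans it; gaining it at \<open>t n + w (x n)\<close> is harmless because it lies on
    the circuit of the next defect, which is there.\<close>
  have Z_cl: "cl (Z (Suc n) i) = cl (Z n i)" if n: "n \<ge> N" for n i
  proof -
    consider "(i - t n) mod int D = 0"
      | "(i - t n) mod int D \<noteq> 0" "(i - t n) mod int D = int (w (x n))"
      | "(i - t n) mod int D \<noteq> 0" "(i - t n) mod int D \<noteq> int (w (x n))" by blast
    thus ?thesis
    proof cases
      case 1
      have "insert (x n) (Z (Suc n) i) = Z n i" using Z_push0[OF n 1] by auto
      moreover have "x n \<in> cl (Z (Suc n) i)" using x_cl[OF n 1 x] Z_push0[OF n 1] by simp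
      ultimately show ?thesis using cl_insert_eq ZE by metis
    next
      case 2
      have "Z (Suc n) i = insert (x n) (Z n i)" "x n \<notin> Z n i"
        using push(1)[of n i] push(3)[of i n] 2 xH[OF n] xA[OF n] by (auto simp: Z_def)
      moreover have "x n \<in> cl (Z (Suc n) i - {x n})"
      proof (rule x_cl)
        show "(i - t (Suc n)) mod int D = 0"
          using mod_diff_eq_iff[of "int (w (x n))" "int D" i "t n"] 2 st(3)[of n] by (simp add: t_Suc)
        show "x n \<in> repair_set (arcs D w (s (Suc n)) (t (Suc n)))"
          unfolding s_Suc t_Suc
          by (rule one_defect_push(2)[OF D def x start])
            (use def[of "Suc n"] in \<open>auto simp: one_defect_def s_Suc\<close>)
      qed (use n in auto)
      ultimately show ?thesis using cl_insert_eq ZE by simp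
    next
      case 3
      thus ?thesis using push(1)[of n i] by (simp add: Z_def)
    qed
  qed
  have Z_clN: "cl (Z n i) = cl (Z N i)" if "n \<ge> N" for n i
    using that by (induction rule: dec_induct) (auto simp: Z_cl)
  have A_cl: "A \<subseteq> cl (Z N i)" for i
  proof
    fix a assume a: "a \<in> A"
    \<comment> \<open>The first start from \<open>s N a\<close> on that is congruent to
      \<open>i\<close>; when \<open>a\<close> reaches it, its arc covers \<open>i\<close>.\<close>
    define c where "c = s N a + (i - s N a) mod int D"
    have "c \<ge> s N a" using D0 by (simp add: c_def)
    then obtain n where n: "n \<ge> N" "s n a = c" using hits[OF a] by auto
    have "i - c = int D * ((i - s N a) div int D)"
      using minus_mod_eq_mult_div[of "i - s N a" "int D"] by (simp add: c_def)
    hence "(i - s n a) mod int D = 0" using n by simp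
    hence "a \<in> Z n i" using a xA_wE by (simp add: Z_def arcs_def)
    thus "a \<in> cl (Z N i)" using Z_clN[OF n(1)] cl_extensive[OF ZE] by blast
  qed

  \<comment> \<open>Intersecting two successive configurations drops \<open>x N\<close> from the
    cover of the defect and leaves the other covers of time \<open>N\<close> intact. So
    \<open>J i \<union> F i\<close> is independent everywhere, while \<open>J i \<union> H i\<close>
    still spans \<open>A\<close>.\<close>
  define J where "J i = arcs D w (s N) i \<inter> arcs D w (s (Suc N)) i \<inter> A" for i
  have arcsN: "arcs D w (s N) i \<inter> arcs D w (s (Suc N)) i =
      (if (i - t N) mod int D = 0 then arcs D w (s (Suc N)) i else arcs D w (s N) i)" for i
    using push(1)[of N i] by auto
  have "A \<subseteq> cl (J i \<union> H i)" for i
  proof -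
    have "J i \<union> H i = (if (i - t N) mod int D = 0 then Z (Suc N) i else Z N i)"
      unfolding J_def Z_def arcsN by auto
    thus ?thesis using A_cl[of i] Z_cl[of N i] by auto
  qed
  moreover have "indep (J i \<union> F i)" for i
  proof -
    have "J i \<union> F i \<subseteq> arcs D w (s N) i \<inter> arcs D w (s (Suc N)) i"
      using F[of N i] F[of "Suc N" i] by (auto simp: J_def)
    moreover have "indep (arcs D w (s N) i \<inter> arcs D w (s (Suc N)) i)"
    proof (cases "(i - t N) mod int D = 0")
      case True
      thus ?thesis using push(1)[of N i] arcsN[of i] arcs_cong[OF True] x[of N]
        by (simp add: repair_set_def)
    next
      case False
      thus ?thesis using arcsN[of i] def[of N] by (simp add: one_defect_def)
    qed
    ultimately show ?thesis using indep_subset by blast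
  qed
  moreover have "F (i + int D) = F i" "J (i + int D) = J i" for i
    using F_cong[of "i + int D" i] arcs_cong[of "i + int D" i] by (simp_all add: J_def)
  moreover have "F i \<subseteq> E - A" "J i \<subseteq> A" for i
    using arcs_in_ground by (auto simp: F_def J_def)
  ultimately have key: "rank (A \<union> (\<Inter>i. F i)) = card (J k) + card (\<Inter>i. F i)" for k
    unfolding H_def by (intro rank_excess_cyclic_Inter[OF D0 AE])
  let ?G = "\<Inter>i. F i"
  have "F 0 \<subseteq> E - A" using arcs_in_ground by (auto simp: F_def)
  hence GE: "?G \<subseteq> E - A" by auto
  have finG: "finite ?G" using GE finite_ground by (meson Diff_subset finite_subset)
  \<comment> \<open>The point just before the start has offset \<open>D - 1\<close>, so only an arc
    of length at least \<open>D\<close> covers it.\<close>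
  have wG: "D \<le> w y" if "y \<in> ?G" for y
  proof -
    have "y \<in> arcs D w (s N) (s N y - 1)" using that by (auto simp: F_def)
    thus ?thesis using D0 by (simp add: arcs_def zmod_minus1)
  qed
  have wD: "w e \<le> D" if "e \<in> E" for e
  proof -
    have "w e \<le> D * rank {e}" using cond[of "{e}"] that by simp
    also have "\<dots> \<le> D" using rank_le_card[of "{e}"] by (metis card.empty card_insert_disjoint
          empty_iff finite.emptyI finite.insertI mult_le_mono2 nat_mult_1_right One_nat_def)
    finally show ?thesis .
  qed
  have "D * card (J 0) = (\<Sum>i<D. card (J (t N + int i)))"
  proof -
    have "card (J (t N + int i)) = card (J 0)" for i
      using key[of "t N + int i"] key[of 0] by linarith
    thus ?thesis by simp
  qed
  \<comment> \<open>Strictness comes from the point \<open>t N\<close>, whose cover contains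
    \<open>x N\<close> while \<open>J (t N)\<close> does not.\<close>
  also have "\<dots> < (\<Sum>i<D. card (arcs D w (s N) (t N + int i) \<inter> A))"
  proof (rule sum_strict_mono_ex1)
    show "\<forall>i\<in>{..<D}. card (J (t N + int i)) \<le> card (arcs D w (s N) (t N + int i) \<inter> A)"
      using finA by (auto simp: J_def intro!: card_mono)
    have "J (t N) \<subset> arcs D w (s N) (t N) \<inter> A"
      using push(1)[of N "t N"] xt[of N] xA[of N] by (auto simp: J_def)
    hence "card (J (t N)) < card (arcs D w (s N) (t N) \<inter> A)"
      using finA by (intro psubset_card_mono) auto
    thus "\<exists>i\<in>{..<D}. card (J (t N + int i)) < card (arcs D w (s N) (t N + int i) \<inter> A)"
      using D0 by (intro bexI[of _ 0]) auto
  qed auto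
  also have "\<dots> = (\<Sum>e\<in>A. w e)" using wD AE by (intro sum_card_arcs[OF D0 AE]) auto
  finally have "D * card (J 0) < (\<Sum>e\<in>A. w e)" .
  moreover have "D * card ?G \<le> (\<Sum>e\<in>?G. w e)"
    using sum_bounded_below[of ?G D w] wG by (simp add: mult.commute)
  moreover have "(\<Sum>e\<in>A \<union> ?G. w e) = (\<Sum>e\<in>A. w e) + (\<Sum>e\<in>?G. w e)"
    using GE finA finG by (intro sum.union_disjoint) auto
  moreover have "(\<Sum>e\<in>A \<union> ?G. w e) \<le> D * (card (J 0) + card ?G)"
    using cond[of "A \<union> ?G"] AE GE key[of 0] by auto
  ultimately show False by (simp add: algebra_simps)
qed


section \<open>Existence of arcs with independent covers\<close>

theorem arcs_indep_exist:
  assumes "D > 0" and "\<And>A. A \<subseteq> E \<Longrightarrow> (\<Sum>e\<in>A. w e) \<le> D * rank A"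
  shows "\<exists>s. \<forall>i. indep (arcs D w s i)"
proof (cases "D = 1")
  \<comment> \<open>The cycle is a single point, so \<open>t - 1\<close> and \<open>t\<close>
    coincide and the pushing argument does not apply.\<close>
  case True
  let ?S = "{e\<in>E. 0 < w e}"
  have "card ?S \<le> (\<Sum>e\<in>?S. w e)" using sum_bounded_below[of ?S 1 w] by fastforce
  hence "card ?S \<le> rank ?S" using assms(2)[of ?S] True by simp
  hence "indep ?S" using finite_ground by (intro indep_if_card_le_rank) auto
  moreover have "arcs D w s i = ?S" for s i using True by (auto simp: arcs_def)
  ultimately show ?thesis by auto
next
  case False
  hence D: "D \<ge> 2" using assms(1) by simp
  show ?thesis using assms(2)
  proof (induction w rule: measure_induct_rule[where f = "\<lambda>w. \<Sum>e\<in>E. w e"])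
    case (less w)
    show ?case
    proof (cases "\<forall>e\<in>E. w e = 0")
      case True
      hence "arcs D w s i = {}" for s i using D by (auto simp: arcs_def not_less)
      thus ?thesis using indep_empty by simp
    next
      case False
      then obtain e where e: "e \<in> E" "0 < w e" by auto
      define w' where "w' = w(e := w e - 1)"
      have "(\<Sum>e\<in>E. w' e) < (\<Sum>e\<in>E. w e)"
        using finite_ground e by (intro sum_strict_mono_ex1) (auto simp: w'_def)
      moreover have "(\<Sum>e\<in>A. w' e) \<le> D * rank A" if "A \<subseteq> E" for A
      proof -
        have "(\<Sum>e\<in>A. w' e) \<le> (\<Sum>e\<in>A. w e)" by (intro sum_mono) (auto simp: w'_def)
        thus ?thesis using less.prems[OF that] by linarith
      qed
      ultimately obtain s where s: "\<And>i. indep (arcs D w' s i)" using less.IH[of w'] by blast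
      have "w e \<le> D * rank {e}" using less.prems[of "{e}"] e by simp
      also have "\<dots> \<le> D * 1" using rank_le_card[of "{e}"] by (intro mult_le_mono2) simp
      finally have we: "w e \<le> D" by simp
      \<comment> \<open>The one point that the arc of \<open>e\<close> gains when its length is
        restored from \<open>w e - 1\<close> to \<open>w e\<close>.\<close>
      define t where "t = s e + int (w e - 1)"
      have e_arcs: "e \<in> arcs D w s i \<longleftrightarrow> (i - t) mod int D = 0 \<or> e \<in> arcs D w' s i" for i
        using mod_diff_eq_iff[of "int (w e - 1)" "int D" i "s e"] e we
        by (auto simp: arcs_def t_def w'_def)
      have arcs_w: "arcs D w s i =
          (if (i - t) mod int D = 0 then insert e (arcs D w' s i) else arcs D w' s i)" for i
      proof (rule set_eqI)
        fix y
        have "y \<noteq> e \<Longrightarrow> y \<in> arcs D w s i \<longleftrightarrow> y \<in> arcs D w' s i" by (simp add: arcs_def w'_def)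
        thus "y \<in> arcs D w s i \<longleftrightarrow>
            y \<in> (if (i - t) mod int D = 0 then insert e (arcs D w' s i) else arcs D w' s i)"
          using e_arcs[of i] by (cases "y = e") auto
      qed
      show ?thesis
      proof (rule ccontr)
        assume "\<not> ?thesis"
        hence none: "\<exists>i. \<not> indep (arcs D w s i)" for s by auto
        have "e \<notin> arcs D w' s t"
          using mod_diff_eq_iff[of "int (w e - 1)" "int D" t "s e"] e we
          by (auto simp: arcs_def t_def w'_def)
        hence "e \<in> repair_set (arcs D w s t)" using arcs_w[of t] s[of t] by (simp add: repair_set_def)
        moreover obtain i where i: "\<not> indep (arcs D w s i)" using none by auto
        hence "(i - t) mod int D = 0" using arcs_w[of i] s[of i] by (auto split: if_splits)
        hence "\<not> indep (arcs D w s t)" using i arcs_cong by metis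
        ultimately have start: "one_defect D w s t" using arcs_w s by (auto simp: one_defect_def)
        \<comment> \<open>\<open>P\<close> is a configuration with a defect and a least advanced
          element starting there, \<open>Q\<close> a single push. As no choice of starts works,
          dependent choice yields an infinite run.\<close>
        define P where "P = (\<lambda>(s, t, x). one_defect D w s t \<and> x \<in> repair_set (arcs D w s t) \<and>
          x \<notin> arcs D w s (t - 1) \<and>
          (\<forall>y. y \<in> repair_set (arcs D w s t) \<longrightarrow> y \<notin> arcs D w s (t - 1) \<longrightarrow> s x \<le> s y))"
        define Q where "Q = (\<lambda>(s, t, x) (s' :: 'a \<Rightarrow> int, t', x' :: 'a). s' = s(x := s x + 1) \<and> t' = t + int (w x))"
        have ex: "\<exists>x. P (s, t, x)" if def: "one_defect D w s t" for s t
        proof -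
          let ?X = "repair_set (arcs D w s t) - arcs D w s (t - 1)"
          have "?X \<noteq> {}" using one_defect_starting_element[OF D def] by auto
          moreover have "finite ?X"
            by (rule finite_subset[OF _ finite_arcs[of D w s t]]) (auto simp: repair_set_def)
          ultimately have "P (s, t, arg_min_on s ?X)"
            using arg_min_if_finite(1)[of ?X s] arg_min_least[of ?X _ s] def by (auto simp: P_def)
          thus ?thesis ..
        qed
        have "\<exists>f. \<forall>n. P (f n) \<and> Q (f n) (f (Suc n))"
        proof (rule dependent_nat_choice[of "\<lambda>_. P" "\<lambda>_. Q"])
          show "\<exists>z. P z" using ex[OF start] by auto
          fix z :: "('a \<Rightarrow> int) \<times> int \<times> 'a"
          assume z: "P z"
          obtain s t x where [simp]: "z = (s, t, x)" by (cases z)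
          have "one_defect D w (s(x := s x + 1)) (t + int (w x))"
            using z by (intro one_defect_push(1)[OF D _ _ _ none]) (auto simp: P_def)
          from ex[OF this] show "\<exists>z'. P z' \<and> Q z z'" by (auto simp: Q_def)
        qed
        then obtain f where f: "\<And>n. P (f n)" "\<And>n. Q (f n) (f (Suc n))" by auto
        show False
          by (rule no_endless_pushing[OF D less.prems, where s = "\<lambda>n. fst (f n)"
                and t = "\<lambda>n. fst (snd (f n))" and x = "\<lambda>n. snd (snd (f n))"])
            (use f in \<open>auto simp: P_def Q_def case_prod_beta\<close>)
      qed
    qed
  qed
qed

section \<open>Cyclic orderings as arcs of equal length\<close>

text \<open>The arc of the element at position \<open>p\<close> covers \<open>p\<close> to
  \<open>p + k - 1\<close>. Modulo \<open>D\<close>, it contains the last position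
  \<open>i + k - 1\<close> of the window exactly if \<open>p\<close> lies in the window.\<close>

lemma cyclically_consecutive_eq_arcs:
  assumes es: "set es = E" and D: "D = length es" and k: "k \<le> D"
    and s: "\<And>j. j < D \<Longrightarrow> (int j - s (es ! j)) mod int D = 0"
  shows "cyclically_consecutive es k i = arcs D (\<lambda>_. k) s (int i + int k - 1)"
proof
  have sh: "(a - s (es ! p)) mod int D = (a - int p) mod int D" if "p < D" for a p
    using s[OF that] by (simp add: mod_eq_dvd_iff mod_eq_0_iff_dvd)
  show "cyclically_consecutive es k i \<subseteq> arcs D (\<lambda>_. k) s (int i + int k - 1)"
  proof
    fix e assume "e \<in> cyclically_consecutive es k i"
    then obtain j where j: "j < k" "e = es ! ((i + j) mod D)"
      by (auto simp: cyclically_consecutive_def D)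
    have p: "(i + j) mod D < D" using j k by simp
    have "(int i + int k - 1 - s e) mod int D = (int i + int k - 1 - int ((i + j) mod D)) mod int D"
      unfolding j(2) by (rule sh[OF p])
    also have "\<dots> = (int i + int k - 1 - int (i + j)) mod int D"
      by (simp add: of_nat_mod mod_diff_right_eq)
    also have "\<dots> = int k - 1 - int j" using j k by simp
    finally show "e \<in> arcs D (\<lambda>_. k) s (int i + int k - 1)"
      using j p es by (auto simp: arcs_def D)
  qed
  show "arcs D (\<lambda>_. k) s (int i + int k - 1) \<subseteq> cyclically_consecutive es k i"
  proof
    fix e assume e: "e \<in> arcs D (\<lambda>_. k) s (int i + int k - 1)"
    then obtain p where p: "p < D" "e = es ! p"
      using es by (metis arcs_in_ground in_set_conv_nth D)
    define q where "q = (int i + int k - 1 - int p) mod int D"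
    have q: "0 \<le> q" "q < int k" using e p sh[of p "int i + int k - 1"] by (auto simp: q_def arcs_def)
    define j where "j = nat (int k - 1 - q)"
    have j: "int j = int k - 1 - q" "j < k" using q by (auto simp: j_def)
    have "int ((i + j) mod D) = (int i + int k - 1 - q) mod int D"
      by (simp add: of_nat_mod j algebra_simps)
    also have "\<dots> = (int i + int k - 1 - (int i + int k - 1 - int p)) mod int D"
      unfolding q_def by (rule mod_diff_right_eq)
    also have "\<dots> = int p" using p by simp
    finally show "e \<in> cyclically_consecutive es k i"
      using p j by (auto simp: cyclically_consecutive_def D intro!: image_eqI[of _ _ j])
  qed
qed

lemma base_if_card_rank:
  assumes "indep B" "card B = rank E"
  shows "base B"
  unfolding base_def
proof (intro conjI allI impI assms)
  fix X assume X: "indep X \<and> B \<subseteq> X"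
  hence "card X \<le> card B" using assms card_le_rank indep_subset_ground by metis
  thus "X = B" using X indep_finite card_seteq by metis
qed

lemma arcs_one:
  assumes "D > 0" shows "arcs D (\<lambda>_. 1) s i = {e\<in>E. (i - s e) mod int D = 0}"
proof -
  have "a mod int D < int 1 \<longleftrightarrow> a mod int D = 0" for a
    using pos_mod_sign[of "int D" a] assms by linarith
  thus ?thesis by (simp add: arcs_def)
qed

text \<open>Arcs of length 1 pick out the elements starting at a point. The covers of
  \<open>i - 1\<close> and \<open>i\<close> have the same size, so as many arcs start at
  \<open>i\<close> as at \<open>i - k\<close>; by Bezout, shifts by \<open>k\<close> reach every
  residue modulo \<open>D\<close>.\<close>

lemma card_arcs_const_start:
  assumes D: "D > 0" and k: "0 < k" "k \<le> D" "coprime D k"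
    and card: "\<And>i. card (arcs D (\<lambda>_. k) s i) = k"
  shows "card (arcs D (\<lambda>_. 1) s i) = card (arcs D (\<lambda>_. 1) s j)"
proof -
  define S where "S i = arcs D (\<lambda>_. 1) s i" for i
  have S: "S i = {e\<in>E. (i - s e) mod int D = 0}" for i
    unfolding S_def by (rule arcs_one[OF D])
  have shift: "card (S i) = card (S (i - int k))" for i
  proof -
    \<comment> \<open>The arcs that cover \<open>i - 1\<close> other than with their last point;
      they belong to both covers.\<close>
    let ?X = "arcs D (\<lambda>_. k - 1) s (i - 1)"
    define m q where "m e = (i - s e) mod int D" and "q e = (i - 1 - s e) mod int D" for e
    have q: "q e = (if m e = 0 then int D - 1 else m e - 1)" "0 \<le> m e" for e
      using pred_mod_int[of "int D" "i - s e"] D by (simp_all add: m_def q_def algebra_simps)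
    have "(i - int k - s e) mod int D = 0 \<longleftrightarrow> q e = int k - 1" for e
      using mod_diff_eq_iff[of "int k - 1" "int D" "i - 1" "s e"] k by (simp add: q_def algebra_simps)
    hence sets: "S (i - int k) = {e\<in>E. q e = int k - 1}" "S i = {e\<in>E. m e = 0}"
      "?X = {e\<in>E. q e < int k - 1}" "arcs D (\<lambda>_. k) s (i - 1) = {e\<in>E. q e < int k}"
      "arcs D (\<lambda>_. k) s i = {e\<in>E. m e < int k}"
      using k by (simp_all add: S m_def q_def arcs_def of_nat_diff)
    have "m e < int k \<longleftrightarrow> m e = 0 \<or> q e < int k - 1" "m e = 0 \<Longrightarrow> \<not> q e < int k - 1" for e
      using q[of e] k by (auto split: if_splits)
    hence "arcs D (\<lambda>_. k) s i = S i \<union> ?X" "S i \<inter> ?X = {}"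
      unfolding sets by blast+
    moreover have "arcs D (\<lambda>_. k) s (i - 1) = S (i - int k) \<union> ?X" "S (i - int k) \<inter> ?X = {}"
      unfolding sets by auto
    moreover have "finite (S i)" for i by (simp add: S_def finite_arcs)
    ultimately have "k = card (S (i - int k)) + card ?X" "k = card (S i) + card ?X"
      using card finite_arcs card_Un_disjoint by metis+
    thus ?thesis by simp
  qed
  have mult: "card (S (i + v * int k)) = card (S i)" for i v
  proof (induction v rule: int_induct[where k = 0])
    case (step1 v)
    thus ?case using shift[of "i + (v + 1) * int k"] by (simp add: algebra_simps)
  next
    case (step2 v)
    thus ?case using shift[of "i + v * int k"] by (simp add: algebra_simps)
  qed auto
  have cong: "S i = S j" if "(i - j) mod int D = 0" for i j
    unfolding S_def by (rule arcs_cong[OF that])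
  obtain u v where uv: "u * int D + v * int k = 1"
    using bezout_int[of "int D" "int k"] k(3) by auto
  have "card (S (i - 1)) = card (S i)" for i
  proof -
    have "i - (i - 1 + v * int k) = u * int D" using uv by (simp add: algebra_simps)
    hence "S i = S (i - 1 + v * int k)" by (intro cong) simp
    thus ?thesis using mult by simp
  qed
  moreover have "S (i + int D) = S i" for i by (rule cong) simp
  ultimately show ?thesis
    using periodic_mono_const[of "\<lambda>i. card (S i)" D i j] D by (simp add: S_def)
qed

text \<open>Covers have at most \<open>rank E\<close> elements and average exactly that, so all are
  bases. Hence every point starts the same number of arcs, which is 1 as there are as many arcs as
  points.\<close>

lemma cyclic_ordering_if_density:
  assumes D: "D = card E" and r: "0 < rank E" and cop: "coprime D (rank E)"
    and dens: "\<And>A. A \<subseteq> E \<Longrightarrow> rank E * card A \<le> D * rank A"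
  shows "\<exists>es. cyclic_ordering E es \<and>
    (\<forall>i<length es. base (cyclically_consecutive es (rank E) i))"
proof -
  have rD: "rank E \<le> D" using rank_le_card[OF finite_ground] D by simp
  hence D0: "D > 0" using r by simp
  obtain s where s: "\<And>i. indep (arcs D (\<lambda>_. rank E) s i)"
    using arcs_indep_exist[OF D0, of "\<lambda>_. rank E"] dens by (auto simp: mult.commute)
  have le: "card (arcs D (\<lambda>_. rank E) s i) \<le> rank E" for i
    using s arcs_subset by (rule card_le_rank)
  have card: "card (arcs D (\<lambda>_. rank E) s i) = rank E" for i
  proof (rule ccontr)
    assume "card (arcs D (\<lambda>_. rank E) s i) \<noteq> rank E"
    hence lt: "card (arcs D (\<lambda>_. rank E) s i) < rank E" using le[of i] by linarith
    have "(\<Sum>j<D. card (arcs D (\<lambda>_. rank E) s (i + int j) \<inter> E)) < (\<Sum>j<D. rank E)"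
      using le lt D0 by (intro sum_strict_mono_ex1) (auto simp: Int_absorb2 arcs_subset intro: bexI[of _ 0])
    thus False using sum_card_arcs[OF D0 subset_refl, of "\<lambda>_. rank E" s i] rD D by simp
  qed
  define S where "S i = arcs D (\<lambda>_. 1) s i" for i
  have one: "card (S i) = 1" for i
  proof -
    have "(\<Sum>j<D. card (S (0 + int j) \<inter> E)) = D"
      using sum_card_arcs[OF D0 subset_refl, of "\<lambda>_. 1" s 0] D0 D by (simp add: S_def)
    moreover have "card (S (0 + int j) \<inter> E) = card (S i)" for j
      using card_arcs_const_start[OF D0 r rD cop card] by (simp add: S_def Int_absorb2 arcs_subset)
    ultimately show ?thesis using D0 by simp
  qed
  hence "\<forall>j. \<exists>e. e \<in> S (int j)" by (metis card.empty ex_in_conv zero_neq_one)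
  then obtain f where f: "\<And>j. f j \<in> S (int j)" by metis
  have fs: "(int j - s (f j)) mod int D = 0" for j
    using f[of j] arcs_one[OF D0] by (simp add: S_def)
  define es where "es = map f [0..<D]"
  have "inj_on f {0..<D}"
  proof (rule inj_onI)
    fix i j assume ij: "i \<in> {0..<D}" "j \<in> {0..<D}" "f i = f j"
    have "(int i - s (f i)) mod int D = (int j - s (f i)) mod int D" using fs[of i] fs[of j] ij by simp
    hence "int i mod int D = int j mod int D" by (simp add: mod_eq_dvd_iff)
    thus "i = j" using ij by simp
  qed
  hence dist: "distinct es" by (simp add: es_def distinct_map)
  have len: "length es = D" by (simp add: es_def)
  have "set es \<subseteq> E" using f by (auto simp: es_def S_def intro: arcs_in_ground)
  hence set: "set es = E"
    using distinct_card[OF dist] len D finite_ground by (intro card_seteq) auto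
  have "cyclically_consecutive es (rank E) i = arcs D (\<lambda>_. rank E) s (int i + int (rank E) - 1)" for i
    by (rule cyclically_consecutive_eq_arcs[OF set len[symmetric] rD]) (use fs in \<open>simp add: es_def\<close>)
  hence "base (cyclically_consecutive es (rank E) i)" for i
    using s card by (simp add: base_if_card_rank)
  thus ?thesis using dist set by (auto simp: cyclic_ordering_def)
qed

text \<open>Double counting: each element of \<open>A\<close> lies in \<open>rank E\<close> windows,
  and every window meets \<open>A\<close> in an independent set.\<close>

lemma density_if_cyclic_ordering:
  assumes es: "cyclic_ordering E es"
    and base: "\<And>i. i < length es \<Longrightarrow> base (cyclically_consecutive es (rank E) i)"
    and A: "A \<subseteq> E"
  shows "rank E * card A \<le> card E * rank A"
proof (cases "E = {}")
  case False
  let ?D = "card E"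
  have set: "set es = E" and dist: "distinct es"
    using es by (auto simp: cyclic_ordering_def)
  have len: "length es = ?D" using distinct_card[OF dist] set by simp
  have D0: "?D > 0" using False finite_ground by auto
  have rD: "rank E \<le> ?D" using rank_le_card[OF finite_ground] .
  define s where "s e = int (inv_into {..<?D} ((!) es) e)" for e
  have "inj_on ((!) es) {..<?D}" using dist len by (auto simp: inj_on_def nth_eq_iff_index_eq)
  hence "s (es ! j) = int j" if "j < ?D" for j using that by (simp add: s_def)
  hence arcs: "cyclically_consecutive es (rank E) i = arcs ?D (\<lambda>_. rank E) s (int i + int (rank E) - 1)" for i
    by (intro cyclically_consecutive_eq_arcs[OF set len[symmetric] rD]) simp
  \<comment> \<open>Beginning at \<open>rank E - 1\<close> matches the points with the last
    positions of the windows \<open>0\<close> to \<open>?D - 1\<close>.\<close>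
  have "rank E * card A = (\<Sum>i<?D. card (arcs ?D (\<lambda>_. rank E) s ((int (rank E) - 1) + int i) \<inter> A))"
    using sum_card_arcs[OF D0 A, of "\<lambda>_. rank E"] rD by (simp add: mult.commute)
  also have "\<dots> = (\<Sum>i<?D. card (cyclically_consecutive es (rank E) i \<inter> A))"
    by (simp add: arcs algebra_simps)
  also have "\<dots> \<le> (\<Sum>i<?D. rank A)"
  proof (intro sum_mono card_le_rank)
    fix i assume "i \<in> {..<?D}"
    thus "indep (cyclically_consecutive es (rank E) i \<inter> A)"
      using base[of i] len indep_subset by (auto simp: base_def)
  qed auto
  finally show ?thesis by simp
qed (use A in auto)

end

theorem theorem1p4:
  fixes E :: "'a set" and indep :: "'a set \<Rightarrow> bool"
  assumes "matroid E indep"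
    and "matroid.loopless E indep"
    and "coprime (card E) (matroid.rank indep E)"
  shows "(\<exists>es. cyclic_ordering E es \<and>
            (\<forall>i<length es.
               matroid.base indep (cyclically_consecutive es (matroid.rank indep E) i)))
    \<longleftrightarrow>
         (\<forall>A. A \<subseteq> E \<and> A \<noteq> {} \<longrightarrow>
            real (card A) / real (matroid.rank indep A)
              \<le> real (card E) / real (matroid.rank indep E))"
proof -
  interpret matroid E indep by fact
  \<comment> \<open>Without loops the denominators are positive, so no quotient takes the default
    value 0 of division by 0.\<close>
  have pos: "0 < rank A" if "A \<subseteq> E" "A \<noteq> {}" for A
  proof -
    from that(2) obtain e where "e \<in> A" by blast
    hence "card {e} \<le> rank A"
      using that assms(2) by (intro card_le_rank) (auto simp: loopless_def)
    thus ?thesis by simp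
  qed
  \<comment> \<open>For empty \<open>E\<close> both numbers would be 0, and 0 is not coprime to
    itself.\<close>
  have "E \<noteq> {}" using assms(3) rank_le_card[OF finite_ground] by auto
  hence posE: "0 < rank E" using pos by simp
  have frac: "real (card A) / real (rank A) \<le> real (card E) / real (rank E)
      \<longleftrightarrow> rank E * card A \<le> card E * rank A" if "A \<subseteq> E" "A \<noteq> {}" for A
  proof -
    have "real (card A) / real (rank A) \<le> real (card E) / real (rank E)
      \<longleftrightarrow> real (rank E * card A) \<le> real (card E * rank A)"
      using pos[OF that] posE by (simp add: divide_simps mult.commute)
    thus ?thesis by (simp only: of_nat_le_iff)
  qed
  show ?thesis
  proof
    assume "\<exists>es. cyclic_ordering E es \<and> (\<forall>i<length es. base (cyclically_consecutive es (rank E) i))"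
    thus "\<forall>A. A \<subseteq> E \<and> A \<noteq> {} \<longrightarrow> real (card A) / real (rank A) \<le> real (card E) / real (rank E)"
      using frac density_if_cyclic_ordering by blast
  next
    assume "\<forall>A. A \<subseteq> E \<and> A \<noteq> {} \<longrightarrow> real (card A) / real (rank A) \<le> real (card E) / real (rank E)"
    hence "rank E * card A \<le> card E * rank A" if "A \<subseteq> E" for A
      using frac[of A] that by (cases "A = {}") auto
    thus "\<exists>es. cyclic_ordering E es \<and> (\<forall>i<length es. base (cyclically_consecutive es (rank E) i))"
      using cyclic_ordering_if_density[OF refl posE assms(3)] by blast
  qed
qed

end
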